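(* Let $V$ be a two-Higgs-doublet potential with parameters $M^\mu$, $\Lambda^{\mu\nu}$ satisfying the positivity constraint, and suppose that there exists one and only one (up to scaling) eigenvector of the $3\times3$ matrix $(\Lambda_{ij})_{i,j=1,2,3}$ orthogonal both to $(\Lambda_{0i})_{i=1,2,3}$ and to $(M_i)_{i=1,2,3}$. Then spontaneously $CP$-violating stationary points of $V$ exist if and only if the components $M^\mu=(M_0,M_1,0,M_3)$ of the prototypical model, in which $\Lambda^{\mu\nu}=\mathrm{diag}(\Lambda_0,-\Lambda_1,-\Lambda_2,-\Lambda_3)$ with the second axis along that eigenvector, satisfy the inequality $$\frac{M_1^2}{(\Lambda_1-\Lambda_2)^2}+\frac{M_3^2}{(\Lambda_3-\Lambda_2)^2}<\frac{M_0^2}{(\Lambda_0-\Lambda_2)^2}.$$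
   Context: Two Higgs doublets $\phi_1,\phi_2\in\mathbb{C}^2$ are given, and the general potential is $V=-M_\mu r^\mu+\frac12\Lambda_{\mu\nu}r^\mu r^\nu$ (sum over repeated indices $0,\dots,3$), with a real four-vector $M^\mu$ and a real symmetric tensor $\Lambda^{\mu\nu}$, where $r^0=\phi_1^\dagger\phi_1+\phi_2^\dagger\phi_2$, $r^1=2\,\mathrm{Re}(\phi_1^\dagger\phi_2)$, $r^2=2\,\mathrm{Im}(\phi_1^\dagger\phi_2)$, $r^3=\phi_1^\dagger\phi_1-\phi_2^\dagger\phi_2$. Indices are raised and lowered with $g=\mathrm{diag}(1,-1,-1,-1)$. Positivity constraint (standing assumption): $\Lambda_{\mu\nu}r^\mu r^\nu>0$ for every nonzero $r$ with $r^0\ge0$, $r^\mu r_\mu\ge0$. Orthogonality of 3-vectors is Euclidean. A reparametrization $\phi_i\mapsto\sum_jU_{ij}\phi_j$ with $U\in SU(2)$ induces an $SO(3)$ rotation of $(r^1,r^2,r^3)$, and with $U\in SL(2,\mathbb{C})$ a proper orthochronous Lorentz transformation $L$ of $r^\mu$; the parameters transform as $M\mapsto LM$, $\Lambda\mapsto L\Lambda L^T$ (upper-index components). Written as a polynomial in the products $\phi_i^\dagger\phi_j$, the potential has all coefficients real in a given basis exactly when $M_2=\Lambda_{02}=\Lambda_{12}=\Lambda_{23}=0$ in that basis. $V$ is explicitly $CP$-conserving if some $SU(2)$ reparametrization makes all its coefficients real; this holds if and only if some eigenvector of $(\Lambda_{ij})$ is orthogonal to both $(\Lambda_{0i})$ and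 $(M_i)$. Prototypical model: first rotate by $SU(2)$ so that the distinguished eigenvector of $(\Lambda_{ij})$ points along the second axis (the potential is then real). Then apply a proper orthochronous Lorentz transformation acting only on the coordinates $0,1,3$ (boosts along axes 1 and 3 and rotations between them) that brings $\Lambda^{\mu\nu}$ to the form $\mathrm{diag}(\Lambda_0,-\Lambda_1,-\Lambda_2,-\Lambda_3)$; by the positivity constraint this is possible, and $\Lambda_0>0$, $\Lambda_0>\Lambda_1,\Lambda_2,\Lambda_3$. The transformed $M^\mu$ has vanishing second component. The stationary points considered are neutral ones: configurations $(\phi_1,\phi_2)\neq(0,0)$ with $\phi_1,\phi_2$ proportional at which the gradient of $V$ with respect to the eight real fields vanishes. For an explicitly $CP$-conserving $V$, such a point is spontaneously $CP$-violating if there is no $SU(2)$ reparametrization after which simultaneously all coefficients of the potential are real and the two doublets at that point have no relative phase, i.e. $\mathrm{Im}(\phi_1^\dagger\phi_2)=0$.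
   Formalization: The condition M^0 > 0 is added to the inequality, since for M^0 < 0 the inequality can hold although V has no nonzero stationary point; when Λ_1 = Λ_2 or Λ_3 = Λ_2, the quotient M_i^2/0 is read as +∞ for M_i ≠ 0 and as 0 for M_i = 0. *)

theory Defs
  imports "HOL-Analysis.Analysis"
begin

text \<open>
  Four-vectors are of type \<^typ>\<open>real^4\<close>, with the index \<open>\<mu>\<close> running over \<open>0, 1, 2, 3\<close>, which
  are the four elements of the index type \<^typ>\<open>4\<close> (so the numeral \<open>4\<close> denotes the time index
  \<open>0\<close>). Three-vectors have the indices \<open>1, 2, 3\<close> of the type \<^typ>\<open>3\<close>.
  The parameters \<open>M\<close> and \<open>\<Lambda>\<close> are always given by their upper-index components \<open>M\<^sup>\<mu>\<close> and
  \<open>\<Lambda>\<^sup>\<mu>\<^sup>\<nu>\<close>.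
\<close>

definition metric :: "real^4^4" where
  "metric = (\<chi> \<mu> \<nu>. if \<mu> = \<nu> then (if \<mu> = 0 then 1 else - 1) else 0)"

definition lower :: "real^4 \<Rightarrow> real^4" where
  "lower x = metric *v x"

definition lower_tensor :: "real^4^4 \<Rightarrow> real^4^4" where
  "lower_tensor T = metric ** T ** metric"

definition spatial :: "real^4 \<Rightarrow> real^3" where
  "spatial x = vector [x $ 1, x $ 2, x $ 3]"

definition from_spatial :: "real^3 \<Rightarrow> real^4" where
  "from_spatial n = (\<chi> \<mu>. if \<mu> = 1 then n $ 1 else if \<mu> = 2 then n $ 2
                         else if \<mu> = 3 then n $ 3 else 0)"

text \<open>\<open>(\<Lambda>\<^sub>i\<^sub>j)\<close> and \<open>(\<Lambda>\<^sub>0\<^sub>i)\<close>, from the lower-index tensor.\<close>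

definition spatial_block :: "real^4^4 \<Rightarrow> real^3^3" where
  "spatial_block T = vector [spatial (T $ 1), spatial (T $ 2), spatial (T $ 3)]"

definition mixed_part :: "real^4^4 \<Rightarrow> real^3" where
  "mixed_part T = spatial (T $ 0)"

definition diag4 :: "real \<Rightarrow> real \<Rightarrow> real \<Rightarrow> real \<Rightarrow> real^4^4" where
  "diag4 a b c d = (\<chi> \<mu> \<nu>. if \<mu> \<noteq> \<nu> then 0 else if \<mu> = 0 then a
                           else if \<mu> = 1 then b else if \<mu> = 2 then c else d)"

text \<open>
  A configuration of the two doublets is a \<open>2 \<times> 2\<close> complex matrix \<open>\<phi>\<close> whose rows \<open>\<phi> $ 1\<close> and
  \<open>\<phi> $ 2\<close> are the doublets; then \<open>U ** \<phi>\<close> is the configuration with the doublets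
  \<open>\<Sum>j. U\<^sub>i\<^sub>j \<phi>\<^sub>j\<close>. Below, \<open>herm \<phi> i j\<close> is the product \<open>\<phi>\<^sub>i\<^sup>\<dagger> \<phi>\<^sub>j\<close>.
\<close>

definition herm :: "complex^2^2 \<Rightarrow> 2 \<Rightarrow> 2 \<Rightarrow> complex" where
  "herm \<phi> i j = (\<Sum>a\<in>UNIV. cnj (\<phi> $ i $ a) * \<phi> $ j $ a)"

definition rvec :: "complex^2^2 \<Rightarrow> real^4" where
  "rvec \<phi> = (\<chi> \<mu>. if \<mu> = 0 then Re (herm \<phi> 1 1) + Re (herm \<phi> 2 2)
                  else if \<mu> = 1 then 2 * Re (herm \<phi> 1 2)
                  else if \<mu> = 2 then 2 * Im (herm \<phi> 1 2)
                  else Re (herm \<phi> 1 1) - Re (herm \<phi> 2 2))"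

definition potential :: "real^4 \<Rightarrow> real^4^4 \<Rightarrow> complex^2^2 \<Rightarrow> real" where
  "potential M \<Lambda> \<phi> = - (lower M \<bullet> rvec \<phi>) + 1/2 * (rvec \<phi> \<bullet> (lower_tensor \<Lambda> *v rvec \<phi>))"

definition positivity_constraint :: "real^4^4 \<Rightarrow> bool" where
  "positivity_constraint \<Lambda> \<longleftrightarrow>
     (\<forall>r. r \<noteq> 0 \<and> r $ 0 \<ge> 0 \<and> r \<bullet> lower r \<ge> 0 \<longrightarrow> r \<bullet> (lower_tensor \<Lambda> *v r) > 0)"

definition dagger :: "complex^2^2 \<Rightarrow> complex^2^2" where
  "dagger U = map_matrix cnj (transpose U)"

definition SU2 :: "(complex^2^2) set" where
  "SU2 = {U. U ** dagger U = mat 1 \<and> det U = 1}"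

text \<open>
  For \<open>U \<in> SU2\<close>, the function \<open>W\<close> expressed in the new doublets \<open>\<phi>' = U ** \<phi>\<close>: the value at
  \<open>\<phi>'\<close> is \<open>W \<phi>\<close>, where \<open>\<phi> = dagger U ** \<phi>'\<close>.
\<close>

definition reparametrize :: "complex^2^2 \<Rightarrow> (complex^2^2 \<Rightarrow> real) \<Rightarrow> complex^2^2 \<Rightarrow> real" where
  "reparametrize U W = (\<lambda>\<phi>. W (dagger U ** \<phi>))"

text \<open>
  As functions of \<open>\<phi>\<close> the four products \<open>\<phi>\<^sub>i\<^sup>\<dagger> \<phi>\<^sub>j\<close> are algebraically independent over the complex
  numbers, so the coefficients of \<open>W\<close> are determined by \<open>W\<close> (for the quartic ones, after
  collecting the equal monomials \<open>(i,j),(k,l)\<close> and \<open>(k,l),(i,j)\<close>); hence they are all real iff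
  some expression of \<open>W\<close> with real coefficients exists.
\<close>

definition real_coefficients :: "(complex^2^2 \<Rightarrow> real) \<Rightarrow> bool" where
  "real_coefficients W \<longleftrightarrow>
     (\<exists>(a :: 2 \<Rightarrow> 2 \<Rightarrow> real) (b :: 2 \<Rightarrow> 2 \<Rightarrow> 2 \<Rightarrow> 2 \<Rightarrow> real). \<forall>\<phi>.
        complex_of_real (W \<phi>) =
          (\<Sum>i\<in>UNIV. \<Sum>j\<in>UNIV. complex_of_real (a i j) * herm \<phi> i j) +
          (\<Sum>i\<in>UNIV. \<Sum>j\<in>UNIV. \<Sum>k\<in>UNIV. \<Sum>l\<in>UNIV.
             complex_of_real (b i j k l) * (herm \<phi> i j * herm \<phi> k l)))"

definition explicitly_CP_conserving :: "(complex^2^2 \<Rightarrow> real) \<Rightarrow> bool" where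
  "explicitly_CP_conserving W \<longleftrightarrow> (\<exists>U\<in>SU2. real_coefficients (reparametrize U W))"

definition neutral_configuration :: "complex^2^2 \<Rightarrow> bool" where
  "neutral_configuration \<phi> \<longleftrightarrow>
     \<phi> \<noteq> 0 \<and> ((\<exists>c. \<phi> $ 2 = c *s \<phi> $ 1) \<or> (\<exists>c. \<phi> $ 1 = c *s \<phi> $ 2))"

text \<open>
  The derivative is the real Frechet derivative on \<^typ>\<open>complex^2^2\<close>, that is, with respect to
  the eight real fields.
\<close>

definition neutral_stationary_point :: "(complex^2^2 \<Rightarrow> real) \<Rightarrow> complex^2^2 \<Rightarrow> bool" where
  "neutral_stationary_point W \<phi> \<longleftrightarrow>
     neutral_configuration \<phi> \<and> (W has_derivative (\<lambda>_. 0)) (at \<phi>)"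

definition spontaneously_CP_violating :: "(complex^2^2 \<Rightarrow> real) \<Rightarrow> complex^2^2 \<Rightarrow> bool" where
  "spontaneously_CP_violating W \<phi> \<longleftrightarrow>
     explicitly_CP_conserving W \<and> neutral_stationary_point W \<phi> \<and>
     \<not> (\<exists>U\<in>SU2. real_coefficients (reparametrize U W) \<and> Im (herm (U ** \<phi>) 1 2) = 0)"

definition CP_eigenvector :: "real^4 \<Rightarrow> real^4^4 \<Rightarrow> real^3 \<Rightarrow> bool" where
  "CP_eigenvector M \<Lambda> n \<longleftrightarrow>
     n \<noteq> 0 \<and> (\<exists>c. spatial_block (lower_tensor \<Lambda>) *v n = c *\<^sub>R n) \<and>
     orthogonal n (mixed_part (lower_tensor \<Lambda>)) \<and> orthogonal n (spatial (lower M))"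

text \<open>The (unique) linear transformation of \<open>r\<^sup>\<mu>\<close> induced by a reparametrization.\<close>

definition induces :: "complex^2^2 \<Rightarrow> real^4^4 \<Rightarrow> bool" where
  "induces U L \<longleftrightarrow> (\<forall>\<phi>. rvec (U ** \<phi>) = L *v rvec \<phi>)"

definition proper_orthochronous :: "real^4^4 \<Rightarrow> bool" where
  "proper_orthochronous L \<longleftrightarrow>
     transpose L ** metric ** L = metric \<and> det L = 1 \<and> L $ 0 $ 0 > 0"

definition acts_only_on_013 :: "real^4^4 \<Rightarrow> bool" where
  "acts_only_on_013 L \<longleftrightarrow> row 2 L = axis 2 1 \<and> column 2 L = axis 2 1"

text \<open>
  \<open>R\<close> is a reparametrization in \<open>SU(2)\<close> that turns \<open>n\<close> into the second axis; \<open>K\<close> is the subsequent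
  Lorentz transformation that diagonalizes the tensor. \<open>M'\<close> and \<open>\<Lambda>0, \<dots>, \<Lambda>3\<close> are the resulting
  parameters of the prototypical model.
\<close>

definition prototypical_model ::
    "real^4 \<Rightarrow> real^4^4 \<Rightarrow> real^3 \<Rightarrow> real^4 \<Rightarrow> real \<Rightarrow> real \<Rightarrow> real \<Rightarrow> real \<Rightarrow> bool" where
  "prototypical_model M \<Lambda> n M' \<Lambda>0 \<Lambda>1 \<Lambda>2 \<Lambda>3 \<longleftrightarrow>
     (\<exists>U R K. U \<in> SU2 \<and> induces U R \<and> (\<exists>c. R *v from_spatial n = axis 2 c) \<and>
        proper_orthochronous K \<and> acts_only_on_013 K \<and>
        M' = (K ** R) *v M \<and>
        (K ** R) ** \<Lambda> ** transpose (K ** R) = diag4 \<Lambda>0 (- \<Lambda>1) (- \<Lambda>2) (- \<Lambda>3))"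

text \<open>
  The quotient of squares \<open>x\<^sup>2 / y\<^sup>2\<close> in the extended reals: it is the real quotient for \<open>y \<noteq> 0\<close>,
  while for \<open>y = 0\<close> it is \<open>\<infinity>\<close> if \<open>x \<noteq> 0\<close>, and \<open>0\<close> if \<open>x = 0\<close>.
  (The real division would give \<open>0\<close> in both cases.)
\<close>

definition sq_quotient :: "real \<Rightarrow> real \<Rightarrow> ereal" where
  "sq_quotient x y = ereal (x\<^sup>2) / ereal (y\<^sup>2)"

end

(*
  A Lorentz transformation A of r maps the neutral stationary points, r lightlike with
  Lambda r - M proportional to r, to those of the transformed parameters; this is used with A the
  product of the rotation and the transformation that lead to the prototypical model.
  There the condition reads (Lambda_mu - zeta) r^mu = M^mu for some zeta. As M^2 = 0, a solution
  with r^2 nonzero has zeta = Lambda_2, hence r^mu = M^mu / (Lambda_mu - Lambda_2) for mu = 0, 1, 3,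
  and the square of r^2 is (r^0)^2 - (r^1)^2 - (r^3)^2, which is positive exactly under the stated
  inequality; r^0 > 0 forces M^0 > 0. If Lambda_i = Lambda_2, then M^i = 0 and r^i is free, with
  r^i = 0 the best choice. (Superscripts on r and M inside the brackets are indices.)
  Lambda_0 > Lambda_2 comes from positivity on the lightlike vector (1, 0, 1, 0).
  Since the distinguished eigenvector is unique, every real basis has it along the second axis, so
  CP is violated exactly when r^2, which is unchanged by the transformation of 0, 1, 3, is nonzero.
*)

theory Submission
  imports Defs
begin

section \<open>Index arithmetic and the forward cone\<close>

text \<open>The library enumerates this index type as 1, 2, 3, 4; rewriting 4 to 0 brings in the
  time index.\<close>

lemma four_eq_zero: "(4::4) = 0" by simp

lemma sum_UNIV_4: "sum f (UNIV::4 set) = f 0 + f 1 + f 2 + f 3"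
  by (simp only: sum_4 four_eq_zero add_ac)

lemma forall_UNIV_4: "(\<forall>i::4. P i) \<longleftrightarrow> P 0 \<and> P 1 \<and> P 2 \<and> P 3"
  unfolding forall_4 four_eq_zero by blast

lemma vec4_eq_iff: "(x::'a^4) = y \<longleftrightarrow> x$0 = y$0 \<and> x$1 = y$1 \<and> x$2 = y$2 \<and> x$3 = y$3"
  by (simp add: vec_eq_iff forall_UNIV_4)

lemma inner_4: "(x::real^4) \<bullet> y = x$0 * y$0 + x$1 * y$1 + x$2 * y$2 + x$3 * y$3"
  by (simp add: inner_vec_def sum_UNIV_4)

lemma matrix_vector_mult_4_nth:
  "((A::real^4^4) *v x) $ i = A$i$0 * x$0 + A$i$1 * x$1 + A$i$2 * x$2 + A$i$3 * x$3"
  by (simp add: matrix_vector_mult_def sum_UNIV_4)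

lemma lower_nth [simp]:
  "lower x $ 0 = x $ 0" "lower x $ 1 = - x $ 1" "lower x $ 2 = - x $ 2" "lower x $ 3 = - x $ 3"
  by (simp_all add: lower_def metric_def matrix_vector_mult_4_nth)

lemma from_spatial_nth [simp]:
  "from_spatial n $ 0 = 0" "from_spatial n $ 1 = n $ 1"
  "from_spatial n $ 2 = n $ 2" "from_spatial n $ 3 = n $ 3"
  by (simp_all add: from_spatial_def)

lemma axis_4_nth [simp]:
  "axis 0 c $ (0::4) = c" "axis 0 c $ (1::4) = 0" "axis 0 c $ (2::4) = 0" "axis 0 c $ (3::4) = 0"
  "axis 2 c $ (0::4) = 0" "axis 2 c $ (1::4) = 0" "axis 2 c $ (2::4) = c" "axis 2 c $ (3::4) = 0"
  by (simp_all add: axis_def)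

section \<open>The vector r of a configuration and the forward cone\<close>

lemma herm_expand: "herm \<phi> i j = cnj (\<phi>$i$1) * \<phi>$j$1 + cnj (\<phi>$i$2) * \<phi>$j$2"
  by (simp add: herm_def sum_2)

lemma rvec_nth:
  "rvec \<phi> $ 0 = Re (herm \<phi> 1 1) + Re (herm \<phi> 2 2)"
  "rvec \<phi> $ 1 = 2 * Re (herm \<phi> 1 2)"
  "rvec \<phi> $ 2 = 2 * Im (herm \<phi> 1 2)"
  "rvec \<phi> $ 3 = Re (herm \<phi> 1 1) - Re (herm \<phi> 2 2)"
  by (simp_all add: rvec_def)

text \<open>Lagrange's identity: the Gram determinant of the two doublets is the squared modulus of
  \<open>det \<phi>\<close>.\<close>

lemma minkowski_rvec: "rvec \<phi> \<bullet> lower (rvec \<phi>) = 4 * (cmod (det \<phi>))\<^sup>2"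
  unfolding inner_4 lower_nth rvec_nth herm_expand det_2 cmod_power2
  by (simp add: power2_eq_square) algebra

lemma rvec_0_pos: "\<phi> \<noteq> 0 \<Longrightarrow> rvec \<phi> $ 0 > 0"
proof -
  assume "\<phi> \<noteq> 0"
  then obtain i j where ij: "\<phi> $ i $ j \<noteq> 0" by (auto simp: vec_eq_iff)
  have "rvec \<phi> $ 0 = (\<Sum>i\<in>UNIV. \<Sum>j\<in>UNIV. (cmod (\<phi>$i$j))\<^sup>2)"
    unfolding rvec_nth herm_expand sum_2 cmod_power2 by (simp add: power2_eq_square)
  also have "\<dots> > 0"
  proof (rule sum_pos2[of _ i])
    show "0 < (\<Sum>j\<in>UNIV. (cmod (\<phi>$i$j))\<^sup>2)"
      by (rule sum_pos2[of _ j]) (use ij in auto)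
  qed (auto intro: sum_nonneg)
  finally show ?thesis .
qed

lemma rvec_onto_cone:
  assumes "x $ 0 \<ge> 0" "x \<bullet> lower x \<ge> 0"
  obtains \<phi> where "rvec \<phi> = x"
proof -
  define a where "a = (x$0 + x$3) / 2"
  define b where "b = (x$0 - x$3) / 2"
  define h where "h = Complex (x$1 / 2) (x$2 / 2)"
  have ab: "a * b \<ge> (cmod h)\<^sup>2"
    using assms(2) unfolding a_def b_def h_def cmod_power2 inner_4
    by (simp add: field_simps power2_eq_square)
  have "(x$3)\<^sup>2 \<le> (x$0)\<^sup>2"
    using assms(2) unfolding inner_4
    by (simp add: power2_eq_square) (smt (verit) zero_le_square)
  then have "\<bar>x$3\<bar> \<le> x$0" using assms(1) by (metis abs_le_square_iff abs_of_nonneg)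
  then have a0: "a \<ge> 0" and b0: "b \<ge> 0" by (auto simp: a_def b_def)
  \<comment> \<open>A Cholesky factor of the positive semidefinite Gram matrix with diagonal
    \<open>a\<close>, \<open>b\<close> and off-diagonal entry \<open>h\<close>. If
    \<open>a = 0\<close>, then \<open>h = 0\<close> and division by zero yields 0, so the same
    formula still works.\<close>
  define \<phi> :: "complex^2^2" where
    "\<phi> = vector [vector [of_real (sqrt a), 0],
       vector [h / of_real (sqrt a), of_real (sqrt (b - (cmod h)\<^sup>2 / a))]]"
  have "rvec \<phi> = x"
  proof (cases "a = 0")
    case True
    then have "h = 0" using ab by simp
    then have "Re h = 0" "Im h = 0" by auto
    then have "x$1 = 0" "x$2 = 0" by (auto simp: h_def)
    then show ?thesis using True \<open>h = 0\<close> b0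
      unfolding vec4_eq_iff rvec_nth herm_expand
      by (simp add: \<phi>_def vector_2) (auto simp: a_def b_def field_simps)
  next
    case False
    then have a: "a > 0" using a0 by simp
    have c: "b - (cmod h)\<^sup>2 / a \<ge> 0" using ab a by (simp add: field_simps)
    have h11: "herm \<phi> 1 1 = of_real a"
      using a by (simp add: herm_expand \<phi>_def vector_2 flip: of_real_mult)
    have h12: "herm \<phi> 1 2 = h"
      using a by (simp add: herm_expand \<phi>_def vector_2)
    have hh: "cnj h * h = of_real ((cmod h)\<^sup>2)" by (subst complex_norm_square) (rule mult.commute)
    have "herm \<phi> 2 2 = cnj h * h / of_real a + of_real (b - (cmod h)\<^sup>2 / a)"
      using a c by (simp add: herm_expand \<phi>_def vector_2 flip: of_real_mult)
    also have "\<dots> = of_real ((cmod h)\<^sup>2 / a) + of_real (b - (cmod h)\<^sup>2 / a)"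
      by (simp only: hh of_real_divide)
    finally have "herm \<phi> 2 2 = of_real ((cmod h)\<^sup>2 / a) + of_real (b - (cmod h)\<^sup>2 / a)" .
    then have h22: "herm \<phi> 2 2 = of_real b" by (simp flip: of_real_add)
    show ?thesis unfolding vec4_eq_iff rvec_nth h11 h12 h22
      by (simp add: a_def b_def h_def field_simps)
  qed
  then show thesis by (rule that)
qed

text \<open>Together with \<open>minkowski_rvec\<close> this turns neutrality into the statement
  that r is nonzero and lightlike.\<close>

lemma neutral_iff_det: "neutral_configuration \<phi> \<longleftrightarrow> \<phi> \<noteq> 0 \<and> det \<phi> = 0"
proof
  assume "neutral_configuration \<phi>"
  then show "\<phi> \<noteq> 0 \<and> det \<phi> = 0"
    unfolding neutral_configuration_def det_2 by auto
next
  assume *: "\<phi> \<noteq> 0 \<and> det \<phi> = 0"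
  then have d: "\<phi>$1$1 * \<phi>$2$2 = \<phi>$1$2 * \<phi>$2$1" by (simp add: det_2)
  have "\<exists>c. \<phi> $ 2 = c *s \<phi> $ 1" if "\<phi>$1$1 \<noteq> 0"
    by (rule exI[of _ "\<phi>$2$1 / \<phi>$1$1"]) (use d that in \<open>auto simp: vec_eq_iff forall_2 field_simps\<close>)
  moreover have "\<exists>c. \<phi> $ 2 = c *s \<phi> $ 1" if "\<phi>$1$2 \<noteq> 0"
    by (rule exI[of _ "\<phi>$2$2 / \<phi>$1$2"]) (use d that in \<open>auto simp: vec_eq_iff forall_2 field_simps\<close>)
  moreover have "\<exists>c. \<phi> $ 1 = c *s \<phi> $ 2" if "\<phi>$1$1 = 0" "\<phi>$1$2 = 0"
    by (rule exI[of _ 0]) (use that in \<open>auto simp: vec_eq_iff forall_2\<close>)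
  ultimately show "neutral_configuration \<phi>"
    unfolding neutral_configuration_def using * by blast
qed

declare transpose_matrix_vector [simp del]

lemma inner_matrix_transpose: "x \<bullet> (A *v y) = (transpose A *v x) \<bullet> (y::real^'n)"
  for x :: "real^'m"
  by (simp add: dot_lmul_matrix transpose_matrix_vector)

lemma transpose_diff: "transpose (A - B) = transpose A - transpose (B :: 'a::ab_group_add^'n^'m)"
  by (simp add: transpose_def vec_eq_iff)

text \<open>Identities valid for all configurations test r only on the forward cone. That cone has
  interior points, so a polynomial vanishing on it vanishes everywhere; this turns such identities
  into matrix equations.\<close>

lemma cone_quadratic_eq_0:
  assumes sym: "transpose S = S"
    and 0: "\<And>\<phi>. a \<bullet> rvec \<phi> + rvec \<phi> \<bullet> (S *v rvec \<phi>) = 0"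
  shows "a = 0" "S = 0"
proof -
  define e :: "real^4" where "e = axis 0 1"
  define q where "q x = x \<bullet> (S *v x)" for x
  have cone: "a \<bullet> x + q x = 0" if "x $ 0 \<ge> 0" "x \<bullet> lower x \<ge> 0" for x
    using rvec_onto_cone[OF that] 0 unfolding q_def by metis
  \<comment> \<open>Scaling by 2 separates the linear from the quadratic part.\<close>
  have cone2: "a \<bullet> x = 0 \<and> q x = 0" if x: "x $ 0 \<ge> 0" "x \<bullet> lower x \<ge> 0" for x
  proof -
    have "a \<bullet> (2 *\<^sub>R x) + q (2 *\<^sub>R x) = 0"
      by (rule cone) (use x in \<open>simp_all add: inner_4 algebra_simps\<close>)
    then have "2 * (a \<bullet> x) + 4 * q x = 0"
      by (simp add: q_def matrix_vector_mult_scaleR)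
    with cone[OF x] show ?thesis by simp
  qed
  \<comment> \<open>Far enough along the time axis, every translate enters the cone.\<close>
  have shift: "a \<bullet> (t *\<^sub>R e + x) = 0 \<and> q (t *\<^sub>R e + x) = 0" if t: "t \<ge> 2 * norm x" for t x
  proof (rule cone2)
    have "\<bar>x $ 0\<bar> \<le> norm x" by (rule component_le_norm_cart)
    with t have *: "t + x $ 0 \<ge> norm x" by linarith
    then show "(t *\<^sub>R e + x) $ 0 \<ge> 0" using norm_ge_zero[of x] unfolding e_def
      by (simp add: order_trans[OF norm_ge_zero])
    have "(norm x)\<^sup>2 \<le> (t + x $ 0)\<^sup>2" using * by (rule power_mono) simp
    then show "(t *\<^sub>R e + x) \<bullet> lower (t *\<^sub>R e + x) \<ge> 0"
      unfolding power2_norm_eq_inner unfolding inner_4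
      by (simp add: e_def power2_eq_square) (smt (verit) zero_le_square)
  qed
  have q_exp: "q (t *\<^sub>R e + x) = t\<^sup>2 * q e + t * (e \<bullet> (S *v x) + x \<bullet> (S *v e)) + q x" for t x
    by (simp add: q_def matrix_vector_right_distrib matrix_vector_mult_scaleR inner_add_left inner_add_right
        power2_eq_square algebra_simps)
  have a: "a \<bullet> x = 0" for x
  proof -
    define t where "t = 2 * norm x"
    have "a \<bullet> (t *\<^sub>R e + x) = 0" "a \<bullet> ((t + 1) *\<^sub>R e + x) = 0"
      using shift[of x t] shift[of x "t + 1"] by (simp_all add: t_def)
    then show ?thesis by (simp add: inner_add_right algebra_simps)
  qed
  then show "a = 0" using inner_eq_zero_iff by blast
  \<comment> \<open>A polynomial in \<open>t\<close> of degree at most 2 with three zeros is zero;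
    \<open>q x\<close> is its constant term.\<close>
  have q: "q x = 0" for x
  proof -
    define t where "t = 2 * norm x"
    define b where "b = e \<bullet> (S *v x) + x \<bullet> (S *v e)"
    have "t\<^sup>2 * q e + t * b + q x = 0" "(t + 1)\<^sup>2 * q e + (t + 1) * b + q x = 0"
      "(t + 2)\<^sup>2 * q e + (t + 2) * b + q x = 0"
      using shift[of x t] shift[of x "t + 1"] shift[of x "t + 2"]
      unfolding q_exp b_def by (simp_all add: t_def)
    moreover from this have "q e = 0" by algebra
    ultimately show ?thesis by algebra
  qed
  have "x \<bullet> (S *v y) = 0" for x y
  proof -
    have "q (x + y) = q x + q y + 2 * (x \<bullet> (S *v y))"
      using inner_matrix_transpose[of y S x] unfolding sym
      by (simp add: q_def matrix_vector_right_distrib inner_add_left inner_add_right inner_commute)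
    then show ?thesis by (simp add: q)
  qed
  then have "S *v y = 0" for y using inner_eq_zero_iff by blast
  then show "S = 0" by (simp add: matrix_eq)
qed

section \<open>Real coefficients\<close>

text \<open>The potential as a function of r with lower-index parameters, so that linear changes of
  r act on \<open>m\<close> and \<open>S\<close> alone.\<close>

definition quad :: "real^4 \<Rightarrow> real^4^4 \<Rightarrow> real^4 \<Rightarrow> real" where
  "quad m S r = - (m \<bullet> r) + 1/2 * (r \<bullet> (S *v r))"

lemma potential_eq_quad: "potential M \<Lambda> \<phi> = quad (lower M) (lower_tensor \<Lambda>) (rvec \<phi>)"
  by (simp add: potential_def quad_def)

abbreviation e2 :: "real^4" where "e2 \<equiv> axis 2 1"

lemma mult_e2: "S *v e2 = column 2 (S::real^4^4)"
  by (simp add: column_def vec4_eq_iff matrix_vector_mult_4_nth)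

text \<open>Only the second component carries an imaginary factor, so real coefficients go with even
  degree in it.\<close>

lemma of_real_rvec:
  "complex_of_real (rvec \<phi> $ 0) = herm \<phi> 1 1 + herm \<phi> 2 2"
  "complex_of_real (rvec \<phi> $ 1) = herm \<phi> 1 2 + herm \<phi> 2 1"
  "complex_of_real (rvec \<phi> $ 2) = - \<i> * (herm \<phi> 1 2 - herm \<phi> 2 1)"
  "complex_of_real (rvec \<phi> $ 3) = herm \<phi> 1 1 - herm \<phi> 2 2"
  unfolding rvec_nth herm_expand by (simp_all add: complex_eq_iff)

text \<open>The vanishing of the four entries with one index 2 is phrased as an eigenvector
  condition on the second axis, because this form can be transported by rotations.\<close>

lemma real_coefficients_iff:
  assumes sym: "transpose S = S"
  shows "real_coefficients (\<lambda>\<phi>. quad m S (rvec \<phi>)) \<longleftrightarrow> m \<bullet> e2 = 0 \<and> (\<exists>c. S *v e2 = c *\<^sub>R e2)"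
proof
  have symn: "S $ i $ j = S $ j $ i" for i j
    using arg_cong[OF sym, of "\<lambda>A. A $ i $ j"] by (simp add: transpose_def)
  {
    assume "m \<bullet> e2 = 0 \<and> (\<exists>c. S *v e2 = c *\<^sub>R e2)"
    then have m2: "m $ 2 = 0" and S2: "S $ 0 $ 2 = 0" "S $ 1 $ 2 = 0" "S $ 3 $ 2 = 0"
      by (auto simp: inner_4 mult_e2 column_def vec4_eq_iff)
    \<comment> \<open>\<open>r\<^sup>\<mu> = \<epsilon>\<^sub>\<mu> \<Sum> s \<mu> i j \<phi>\<^sub>i\<^sup>\<dagger> \<phi>\<^sub>j\<close> with
      \<open>\<epsilon>\<^sub>2 = - \<i>\<close> and the other \<open>\<epsilon>\<^sub>\<mu> = 1\<close>; the sign in \<open>b\<close> below is \<open>\<epsilon>\<^sub>2\<^sup>2\<close>.\<close>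
    define s :: "4 \<Rightarrow> 2 \<Rightarrow> 2 \<Rightarrow> real" where
      "s \<mu> i j = (if \<mu> = 0 then (if i = j then 1 else 0) else if \<mu> = 1 then (if i \<noteq> j then 1 else 0)
        else if \<mu> = 2 then (if i = j then 0 else if i = 1 then 1 else - 1)
        else if i \<noteq> j then 0 else if i = 1 then 1 else - 1)" for \<mu> i j
    define a where "a i j = - (\<Sum>\<mu>\<in>UNIV. m $ \<mu> * s \<mu> i j)" for i j
    define T where "T \<mu> \<nu> = S $ \<mu> $ \<nu> / 2" for \<mu> \<nu>
    have T2: "T 0 2 = 0" "T 1 2 = 0" "T 3 2 = 0" "T 2 0 = 0" "T 2 1 = 0" "T 2 3 = 0"
      using S2 symn[of 2 0] symn[of 2 1] symn[of 2 3] by (simp_all add: T_def)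
    define b where "b i j k l = (\<Sum>\<mu>\<in>UNIV. \<Sum>\<nu>\<in>UNIV. T \<mu> \<nu> *
        (if \<mu> = 2 then - 1 else 1) * s \<mu> i j * s \<nu> k l)" for i j k l
    show "real_coefficients (\<lambda>\<phi>. quad m S (rvec \<phi>))"
      unfolding real_coefficients_def
    proof (intro exI allI)
      fix \<phi>
      have quad_T: "quad m S r = - (\<Sum>\<mu>\<in>UNIV. m $ \<mu> * r $ \<mu>) +
          (\<Sum>\<mu>\<in>UNIV. \<Sum>\<nu>\<in>UNIV. T \<mu> \<nu> * (r $ \<mu> * r $ \<nu>))" for r
        unfolding quad_def inner_4 matrix_vector_mult_4_nth sum_UNIV_4 T_def by (simp add: field_simps)
      show "complex_of_real (quad m S (rvec \<phi>)) =
        (\<Sum>i\<in>UNIV. \<Sum>j\<in>UNIV. complex_of_real (a i j) * herm \<phi> i j) +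
          (\<Sum>i\<in>UNIV. \<Sum>j\<in>UNIV. \<Sum>k\<in>UNIV. \<Sum>l\<in>UNIV.
             complex_of_real (b i j k l) * (herm \<phi> i j * herm \<phi> k l))"
        unfolding quad_T sum_2 a_def b_def sum_UNIV_4 s_def
        by (simp add: m2 T2 of_real_rvec) (simp add: algebra_simps)
    qed
  }
  assume "real_coefficients (\<lambda>\<phi>. quad m S (rvec \<phi>))"
  then obtain a b where ab: "\<And>\<phi>. complex_of_real (quad m S (rvec \<phi>)) =
        (\<Sum>i\<in>UNIV. \<Sum>j\<in>UNIV. complex_of_real (a i j) * herm \<phi> i j) +
          (\<Sum>i\<in>UNIV. \<Sum>j\<in>UNIV. \<Sum>k\<in>UNIV. \<Sum>l\<in>UNIV.
             complex_of_real (b i j k l) * (herm \<phi> i j * herm \<phi> k l))"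
    unfolding real_coefficients_def by blast
  \<comment> \<open>Conjugating the fields conjugates the products \<open>\<phi>\<^sub>i\<^sup>\<dagger> \<phi>\<^sub>j\<close>, which only flips \<open>r\<^sup>2\<close>; real
    coefficients make the potential invariant under this.\<close>
  define F where "F = diag4 1 1 (- 1) 1"
  have inv: "quad m S (F *v rvec \<phi>) = quad m S (rvec \<phi>)" for \<phi>
  proof -
    have h: "herm (map_matrix cnj \<phi>) i j = cnj (herm \<phi> i j)" for i j
      by (simp add: herm_expand map_matrix_def)
    have "F *v rvec \<phi> = rvec (map_matrix cnj \<phi>)"
      by (simp add: vec4_eq_iff matrix_vector_mult_4_nth rvec_nth h) (simp add: F_def diag4_def)
    then have "complex_of_real (quad m S (F *v rvec \<phi>)) = cnj (complex_of_real (quad m S (rvec \<phi>)))"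
      by (simp only: ab h complex_cnj_add complex_cnj_mult complex_cnj_complex_of_real cnj_sum)
    then show ?thesis by (metis complex_cnj_complex_of_real of_real_eq_iff)
  qed
  have FT: "transpose F = F" by (simp add: F_def diag4_def transpose_def vec_eq_iff)
  \<comment> \<open>Invariance under \<open>F\<close> says that a linear and a quadratic form in r
    cancel on the cone.\<close>
  have "(m - F *v m) \<bullet> rvec \<phi> + rvec \<phi> \<bullet> ((1/2) *\<^sub>R (F ** S ** F - S) *v rvec \<phi>) = 0" for \<phi>
    using inv[of \<phi>] inner_matrix_transpose[of m F "rvec \<phi>"]
      inner_matrix_transpose[of "rvec \<phi>" F "S *v (F *v rvec \<phi>)"]
    unfolding quad_def
    by (simp add: FT inner_diff_left inner_diff_right matrix_vector_mult_diff_rdistrib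
        diff_divide_distrib
        flip: matrix_vector_mul_assoc scaleR_matrix_vector_assoc)
  moreover have "transpose ((1/2) *\<^sub>R (F ** S ** F - S)) = (1/2) *\<^sub>R (F ** S ** F - S)"
    by (simp add: transpose_scalar transpose_diff matrix_transpose_mul FT sym matrix_mul_assoc)
  ultimately have "m - F *v m = 0" and "(1/2) *\<^sub>R (F ** S ** F - S) = 0"
    using cone_quadratic_eq_0 by blast+
  then have m: "F *v m = m" and S: "F ** S ** F = S" by auto
  \<comment> \<open>Since \<open>F\<close> negates \<open>e2\<close>, this puts
    \<open>S *v e2\<close> into the eigenspace of \<open>F\<close> for -1, which is the second axis.
    In the same way \<open>F *v m = m\<close> removes the second component of
    \<open>m\<close>.\<close>
  have "S *v e2 = F *v (S *v (F *v e2))"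
    by (metis S matrix_vector_mul_assoc)
  then show "m \<bullet> e2 = 0 \<and> (\<exists>c. S *v e2 = c *\<^sub>R e2)"
    using m
    by (auto simp: vec4_eq_iff matrix_vector_mult_4_nth inner_4) (auto simp: F_def diag4_def)
qed

section \<open>Rotations induced by SU(2)\<close>

definition herm_matrix :: "complex^2^2 \<Rightarrow> complex^2^2" where
  "herm_matrix \<phi> = map_matrix cnj \<phi> ** transpose \<phi>"

lemma herm_matrix_nth: "herm_matrix \<phi> $ i $ j = herm \<phi> i j"
  by (simp add: herm_matrix_def map_matrix_def matrix_matrix_mult_def transpose_def herm_def)

lemma map_matrix_cnj_mult: "map_matrix cnj (A ** B) = map_matrix cnj A ** map_matrix cnj B"
  for A B :: "complex^2^2"
  by (simp add: map_matrix_def matrix_matrix_mult_def vec_eq_iff)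

lemma herm_matrix_mult:
  "herm_matrix (U ** \<phi>) = map_matrix cnj U ** herm_matrix \<phi> ** transpose U"
  by (simp add: herm_matrix_def map_matrix_cnj_mult matrix_transpose_mul matrix_mul_assoc)

text \<open>The Gram matrix of the doublets and r determine each other real-linearly, and
  \<open>U\<close> acts on the Gram matrix by a congruence, which is linear.\<close>

lemma induces_exists: "\<exists>R. induces U R"
proof -
  \<comment> \<open>Half the expansion in the identity and the transposed Pauli matrices;
    \<open>V\<close> below reads the coefficients off again.\<close>
  define H :: "real^4 \<Rightarrow> complex^2^2" where
    "H r = vector [vector [of_real ((r$0 + r$3) / 2), Complex (r$1 / 2) (r$2 / 2)],
             vector [Complex (r$1 / 2) (- r$2 / 2), of_real ((r$0 - r$3) / 2)]]" for r
  define V :: "complex^2^2 \<Rightarrow> real^4" where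
    "V h = (\<chi> \<mu>. if \<mu> = 0 then Re (h$1$1) + Re (h$2$2) else if \<mu> = 1 then 2 * Re (h$1$2)
        else if \<mu> = 2 then 2 * Im (h$1$2) else Re (h$1$1) - Re (h$2$2))" for h
  define f where "f r = V (map_matrix cnj U ** H r ** transpose U)" for r
  have HV: "H (rvec \<phi>) = herm_matrix \<phi>" for \<phi>
    by (simp add: vec_eq_iff forall_2 herm_matrix_nth H_def vector_2 rvec_nth complex_eq_iff)
      (simp add: herm_expand)
  have "rvec \<phi> = V (herm_matrix \<phi>)" for \<phi>
    unfolding V_def rvec_def herm_matrix_nth ..
  from this[of "U ** _"] have f: "rvec (U ** \<phi>) = f (rvec \<phi>)" for \<phi>
    by (simp only: f_def HV flip: herm_matrix_mult)
  have Hl: "H (x + y) = H x + H y" "H (c *\<^sub>R x) = c *\<^sub>R H x" for x y c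
    by (simp_all add: vec_eq_iff forall_2 H_def vector_2 complex_eq_iff field_simps)
  have Vl: "V (x + y) = V x + V y" "V (c *\<^sub>R x) = c *\<^sub>R V x" for x y c
    by (simp_all add: V_def vec4_eq_iff algebra_simps)
  have add_rdist: "(A + B) ** C = A ** C + B ** C" for A B C :: "complex^2^2"
    by (simp add: matrix_matrix_mult_def vec_eq_iff sum.distrib distrib_right)
  have "linear f"
    by (rule linearI)
      (simp_all add: f_def Hl Vl matrix_add_ldistrib add_rdist
        matrix_scalar_ac scalar_matrix_assoc[symmetric])
  then have "induces U (matrix f)"
    by (simp add: induces_def f matrix_works linear_matrix_vector_mul_eq)
  then show ?thesis by blast
qed

lemma SU2_left: "U \<in> SU2 \<Longrightarrow> dagger U ** U = mat 1"
  by (simp add: SU2_def matrix_left_right_inverse)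

lemma dagger_mult: "dagger (A ** B) = dagger B ** dagger A"
  by (simp add: dagger_def matrix_transpose_mul map_matrix_cnj_mult)

text \<open>As a trace, the time component is visibly invariant under a unitary
  \<open>U\<close>.\<close>

lemma rvec_0_trace: "rvec \<phi> $ 0 = Re (trace (dagger \<phi> ** \<phi>))"
  unfolding rvec_nth herm_expand trace_def sum_2
  by (simp add: matrix_matrix_mult_def dagger_def map_matrix_def transpose_def sum_2)

lemma rvec_0_SU2: "U \<in> SU2 \<Longrightarrow> rvec (U ** \<phi>) $ 0 = rvec \<phi> $ 0"
  unfolding rvec_0_trace dagger_mult
  by (metis SU2_left matrix_mul_assoc matrix_mul_lid)

text \<open>In this form, a linear map that fixes the time axis and preserves time components
  clearly commutes with \<open>lower\<close>.\<close>

lemma lower_eq_time_reflection: "lower x = (2 * x $ 0) *\<^sub>R axis 0 1 - x"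
  by (simp add: vec4_eq_iff)

lemma inner_eq_lower: "x \<bullet> y = 2 * (x $ 0 * y $ 0) - x \<bullet> lower y"
  by (simp add: inner_4)

context
  fixes U R assumes U: "U \<in> SU2" and R: "induces U R"
begin

lemma induced_rvec: "rvec (U ** \<phi>) = R *v rvec \<phi>"
  using R by (simp add: induces_def)

text \<open>\<open>U\<close> preserves both the time component of r and \<open>det \<phi>\<close>,
  hence the Euclidean norm of r. This is known only on the cone; \<open>cone_quadratic_eq_0\<close>
  extends it to all vectors.\<close>

lemma induced_orthogonal: "transpose R ** R = mat 1" "R ** transpose R = mat 1"
proof -
  have "rvec (U ** \<phi>) \<bullet> rvec (U ** \<phi>) = rvec \<phi> \<bullet> rvec \<phi>" for \<phi>
  proof -
    have "det (U ** \<phi>) = det \<phi>" using U by (simp add: SU2_def det_mul)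
    then show ?thesis
      unfolding inner_eq_lower[of "rvec _" "rvec _"] minkowski_rvec rvec_0_SU2[OF U] by simp
  qed
  then have "0 \<bullet> rvec \<phi> + rvec \<phi> \<bullet> ((transpose R ** R - mat 1) *v rvec \<phi>) = 0" for \<phi>
    using inner_matrix_transpose[of "R *v rvec \<phi>" R "rvec \<phi>"] unfolding induced_rvec
    by (simp add: matrix_vector_mult_diff_rdistrib inner_diff_right inner_commute
        flip: matrix_vector_mul_assoc)
  moreover have "transpose (transpose R ** R - mat 1) = transpose R ** R - mat 1"
    by (simp add: transpose_diff matrix_transpose_mul transpose_mat)
  ultimately have "transpose R ** R - mat 1 = 0"
    by (rule cone_quadratic_eq_0(2)[rotated])
  then show "transpose R ** R = mat 1" by simp
  then show "R ** transpose R = mat 1" by (simp add: matrix_left_right_inverse)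
qed

lemma induced_cancel [simp]: "transpose R *v (R *v x) = x" "R *v (transpose R *v x) = x"
  by (simp_all add: matrix_vector_mul_assoc induced_orthogonal)

lemma induced_time: "(transpose R *v axis 0 1) = axis 0 1" "R *v axis 0 1 = axis 0 1"
proof -
  have "(transpose R *v axis 0 1 - axis 0 1) \<bullet> rvec \<phi> + rvec \<phi> \<bullet> (0 *v rvec \<phi>) = 0" for \<phi>
    using inner_matrix_transpose[of "axis 0 1" R "rvec \<phi>"] rvec_0_SU2[OF U, of \<phi>] unfolding induced_rvec
    by (simp add: inner_diff_left inner_axis')
  moreover have "transpose 0 = (0 :: real^4^4)" by (simp add: transpose_def vec_eq_iff)
  ultimately have "transpose R *v axis 0 1 - axis 0 1 = 0"
    using cone_quadratic_eq_0(1) by blast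
  then show "transpose R *v axis 0 1 = axis 0 1" by simp
  then show "R *v axis 0 1 = axis 0 1" using induced_cancel(2)[of "axis 0 1"] by simp
qed

lemma induced_0: "(R *v x) $ 0 = x $ 0" "(transpose R *v x) $ 0 = x $ 0"
  using inner_matrix_transpose[of "axis 0 1" R x] inner_matrix_transpose[of "axis 0 1" "transpose R" x]
  by (simp_all add: induced_time inner_axis')

lemma induced_lower: "lower (R *v x) = R *v lower x"
  unfolding lower_eq_time_reflection induced_0
  by (simp add: matrix_vector_mult_diff_distrib matrix_vector_mult_scaleR induced_time)

lemma dagger_induced: "rvec (dagger U ** \<phi>) = transpose R *v rvec \<phi>"
proof -
  have "R *v rvec (dagger U ** \<phi>) = rvec \<phi>"
    using U by (simp add: induced_rvec[symmetric] matrix_mul_assoc SU2_def)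
  then show ?thesis using induced_cancel(1)[of "rvec (dagger U ** \<phi>)"] by simp
qed

lemma quad_induced:
  "quad m S (transpose R *v r) = quad (R *v m) (R ** S ** transpose R) r"
  using inner_matrix_transpose[of m "transpose R" r]
    inner_matrix_transpose[of r R]
  by (simp add: quad_def flip: matrix_vector_mul_assoc)

text \<open>In the new basis the parameters are \<open>R *v m\<close> and
  \<open>R ** S ** transpose R\<close>; the orthogonal \<open>R\<close> pulls the condition on
  \<open>e2\<close> back to the old basis.\<close>

lemma real_coefficients_reparametrize_iff:
  assumes sym: "transpose S = S"
  shows "real_coefficients (reparametrize U (\<lambda>\<phi>. quad m S (rvec \<phi>))) \<longleftrightarrow>
    m \<bullet> (transpose R *v e2) = 0 \<and> (\<exists>c. S *v (transpose R *v e2) = c *\<^sub>R (transpose R *v e2))"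
proof -
  have *: "transpose (R ** S ** transpose R) = R ** S ** transpose R"
    by (simp add: matrix_transpose_mul sym matrix_mul_assoc)
  have "(R ** S ** transpose R) *v e2 = c *\<^sub>R e2 \<longleftrightarrow>
      S *v (transpose R *v e2) = c *\<^sub>R (transpose R *v e2)" for c
    using induced_cancel(1)[of "S *v (transpose R *v e2)"]
      induced_cancel(2)[of e2] matrix_vector_mult_scaleR[of R c "transpose R *v e2"]
    unfolding matrix_vector_mul_assoc[symmetric]
    by (metis induced_cancel)
  then show ?thesis
    unfolding reparametrize_def dagger_induced quad_induced real_coefficients_iff[OF *]
    using inner_matrix_transpose[of m "transpose R" e2] by simp
qed

end

section \<open>CP eigenvectors as eigenvectors of the four-dimensional tensor\<close>

lemma transpose_metric: "transpose metric = metric"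
  by (auto simp: metric_def transpose_def vec_eq_iff)

lemma transpose_lower_tensor:
  "transpose \<Lambda> = \<Lambda> \<Longrightarrow> transpose (lower_tensor \<Lambda>) = lower_tensor \<Lambda>"
  unfolding lower_tensor_def
  by (simp add: matrix_transpose_mul matrix_mul_assoc transpose_metric)

text \<open>Orthogonality to the mixed part is the time component of the eigenvector equation for
  the full tensor, so the two conditions on \<Lambda> merge into one.\<close>

lemma CP_eigenvector_iff:
  assumes "transpose \<Lambda> = \<Lambda>"
  shows "CP_eigenvector M \<Lambda> n \<longleftrightarrow> n \<noteq> 0 \<and> lower M \<bullet> from_spatial n = 0 \<and>
    (\<exists>c. lower_tensor \<Lambda> *v from_spatial n = c *\<^sub>R from_spatial n)"
proof -
  define S where "S = lower_tensor \<Lambda>"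
  have "(spatial_block S *v n) $ 1 = (S *v from_spatial n) $ 1"
     "(spatial_block S *v n) $ 2 = (S *v from_spatial n) $ 2"
     "(spatial_block S *v n) $ 3 = (S *v from_spatial n) $ 3"
     "n \<bullet> mixed_part S = (S *v from_spatial n) $ 0"
    unfolding matrix_vector_mult_4_nth
    by (simp_all add: spatial_block_def spatial_def mixed_part_def matrix_vector_mult_def
       inner_vec_def sum_3 vector_3)
  moreover have "n \<bullet> spatial (lower M) = lower M \<bullet> from_spatial n"
    by (simp add: spatial_def inner_4 inner_vec_def sum_3 vector_3)
  ultimately show ?thesis
    unfolding CP_eigenvector_def S_def[symmetric] orthogonal_def
    by (auto simp: vec4_eq_iff vec_eq_iff[where 'b = 3] forall_3)
qed

section \<open>Neutral stationary points\<close>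

definition herm_sesqui :: "complex^2^2 \<Rightarrow> complex^2^2 \<Rightarrow> 2 \<Rightarrow> 2 \<Rightarrow> complex" where
  "herm_sesqui \<phi> \<psi> i j = cnj (\<phi>$i$1) * \<psi>$j$1 + cnj (\<phi>$i$2) * \<psi>$j$2"

text \<open>Exhibits \<open>rvec\<close> as the diagonal of a real-bilinear map, so that the product
  rule gives its derivative.\<close>

definition rvec_sesqui :: "complex^2^2 \<Rightarrow> complex^2^2 \<Rightarrow> real^4" where
  "rvec_sesqui \<phi> \<psi> = (\<chi> \<mu>. if \<mu> = 0 then Re (herm_sesqui \<phi> \<psi> 1 1) + Re (herm_sesqui \<phi> \<psi> 2 2)
                  else if \<mu> = 1 then 2 * Re (herm_sesqui \<phi> \<psi> 1 2)
                  else if \<mu> = 2 then 2 * Im (herm_sesqui \<phi> \<psi> 1 2)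
                  else Re (herm_sesqui \<phi> \<psi> 1 1) - Re (herm_sesqui \<phi> \<psi> 2 2))"

lemma rvec_sesqui_nth:
  "rvec_sesqui \<phi> \<psi> $ 0 = Re (herm_sesqui \<phi> \<psi> 1 1) + Re (herm_sesqui \<phi> \<psi> 2 2)"
  "rvec_sesqui \<phi> \<psi> $ 1 = 2 * Re (herm_sesqui \<phi> \<psi> 1 2)"
  "rvec_sesqui \<phi> \<psi> $ 2 = 2 * Im (herm_sesqui \<phi> \<psi> 1 2)"
  "rvec_sesqui \<phi> \<psi> $ 3 = Re (herm_sesqui \<phi> \<psi> 1 1) - Re (herm_sesqui \<phi> \<psi> 2 2)"
  by (simp_all add: rvec_sesqui_def)

lemma rvec_eq_sesqui: "rvec \<phi> = rvec_sesqui \<phi> \<phi>"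
  unfolding vec4_eq_iff rvec_nth rvec_sesqui_nth herm_expand herm_sesqui_def by simp

lemma bounded_bilinear_rvec_sesqui: "bounded_bilinear rvec_sesqui"
proof -
  have "bilinear rvec_sesqui"
    unfolding bilinear_def
    by (intro allI conjI linearI)
      (simp_all add: vec4_eq_iff rvec_sesqui_nth herm_sesqui_def algebra_simps)
  then show ?thesis by (simp add: bilinear_conv_bounded_bilinear)
qed

definition drvec :: "complex^2^2 \<Rightarrow> complex^2^2 \<Rightarrow> real^4" where
  "drvec \<phi> \<psi> = rvec_sesqui \<phi> \<psi> + rvec_sesqui \<psi> \<phi>"

lemma rvec_has_derivative: "(rvec has_derivative drvec \<phi>) (at \<phi>)"
  using bounded_bilinear.FDERIV[OF bounded_bilinear_rvec_sesqui has_derivative_ident has_derivative_ident, of \<phi>]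
  by (simp add: rvec_eq_sesqui[abs_def] drvec_def[abs_def])

lemma quad_has_derivative:
  assumes "transpose S = S"
  shows "(quad m S has_derivative (\<lambda>v. (S *v r - m) \<bullet> v)) (at r)"
proof -
  have "(quad m S has_derivative (\<lambda>v. - (m \<bullet> v) + 1/2 * (r \<bullet> (S *v v) + v \<bullet> (S *v r)))) (at r)"
    unfolding quad_def[abs_def]
    by (auto intro!: derivative_eq_intros bounded_linear.has_derivative[OF matrix_vector_mul_bounded_linear])
  moreover have "- (m \<bullet> v) + 1/2 * (r \<bullet> (S *v v) + v \<bullet> (S *v r)) = (S *v r - m) \<bullet> v" for v
    using inner_matrix_transpose[of r S v] unfolding assms
    by (simp add: inner_diff_left inner_diff_right inner_commute)
  ultimately show ?thesis by simp
qed

lemma stationary_iff_drvec: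
  assumes "transpose S = S"
  shows "((\<lambda>\<phi>. quad m S (rvec \<phi>)) has_derivative (\<lambda>_. 0)) (at \<phi>) \<longleftrightarrow>
    (\<forall>\<psi>. (S *v rvec \<phi> - m) \<bullet> drvec \<phi> \<psi> = 0)"
proof -
  have "((\<lambda>\<phi>. quad m S (rvec \<phi>)) has_derivative (\<lambda>\<psi>. (S *v rvec \<phi> - m) \<bullet> drvec \<phi> \<psi>)) (at \<phi>)"
    using has_derivative_compose[OF rvec_has_derivative quad_has_derivative[OF assms]] .
  then show ?thesis
    by (auto simp: fun_eq_iff dest: has_derivative_unique)
qed

text \<open>Half the derivative of \<open>minkowski_rvec\<close>; the last factor is the derivative
  of \<open>det\<close> at \<phi> in the direction \<psi>.\<close>

lemma lower_inner_drvec: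
  "lower (rvec \<phi>) \<bullet> drvec \<phi> \<psi> = 4 * Re (cnj (det \<phi>) *
     (\<phi>$1$1 * \<psi>$2$2 + \<psi>$1$1 * \<phi>$2$2 - \<phi>$1$2 * \<psi>$2$1 - \<psi>$1$2 * \<phi>$2$1))"
  unfolding inner_4 lower_nth drvec_def rvec_eq_sesqui vector_add_component rvec_sesqui_nth herm_sesqui_def det_2
  by (simp add: algebra_simps)

text \<open>At a neutral configuration the variations of r fill the hyperplane tangent to the light
  cone, whose normal is \<open>lower (rvec \<phi>)\<close>; thus \<zeta> is a Lagrange
  multiplier.\<close>

lemma drvec_orthogonal_iff:
  assumes \<phi>: "\<phi> \<noteq> 0" "det \<phi> = 0"
  shows "(\<forall>\<psi>. p \<bullet> drvec \<phi> \<psi> = 0) \<longleftrightarrow> (\<exists>\<zeta>. p = \<zeta> *\<^sub>R lower (rvec \<phi>))"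
proof
  assume "\<exists>\<zeta>. p = \<zeta> *\<^sub>R lower (rvec \<phi>)"
  then show "\<forall>\<psi>. p \<bullet> drvec \<phi> \<psi> = 0" using \<phi> by (auto simp: lower_inner_drvec)
next
  \<comment> \<open>The variation of \<open>\<phi>\<close> along \<open>\<sigma>\<^sub>k \<phi>\<close> changes \<open>r\<close> by an infinitesimal boost along the axis \<open>k\<close>,
    so \<open>p\<^sub>0 r\<^sub>k + p\<^sub>k r\<^sub>0 = 0\<close>.\<close>
  assume p: "\<forall>\<psi>. p \<bullet> drvec \<phi> \<psi> = 0"
  define r where "r = rvec \<phi>"
  have r0: "r $ 0 > 0" using \<phi> by (simp add: r_def rvec_0_pos)
  have "p $ 0 * r $ 1 + p $ 1 * r $ 0 = 0"
    using p[rule_format, of "vector [\<phi> $ 2, \<phi> $ 1]"]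
    unfolding inner_4 drvec_def vector_add_component rvec_sesqui_nth herm_sesqui_def r_def rvec_nth herm_expand
    by (simp add: vector_2 algebra_simps)
  moreover have "p $ 0 * r $ 2 + p $ 2 * r $ 0 = 0"
    using p[rule_format, of "vector [(- \<i>) *s \<phi> $ 2, \<i> *s \<phi> $ 1]"]
    unfolding inner_4 drvec_def vector_add_component rvec_sesqui_nth herm_sesqui_def r_def rvec_nth herm_expand
    by (simp add: vector_2 algebra_simps)
  moreover have "p $ 0 * r $ 3 + p $ 3 * r $ 0 = 0"
    using p[rule_format, of "vector [\<phi> $ 1, - \<phi> $ 2]"]
    unfolding inner_4 drvec_def vector_add_component rvec_sesqui_nth herm_sesqui_def r_def rvec_nth herm_expand
    by (simp add: vector_2 algebra_simps)
  ultimately have "p = (p $ 0 / r $ 0) *\<^sub>R lower r"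
    using r0 by (simp add: vec4_eq_iff field_simps)
  then show "\<exists>\<zeta>. p = \<zeta> *\<^sub>R lower (rvec \<phi>)" unfolding r_def by blast
qed

lemma neutral_stationary_iff:
  assumes "transpose S = S"
  shows "neutral_stationary_point (\<lambda>\<phi>. quad m S (rvec \<phi>)) \<phi> \<longleftrightarrow>
    \<phi> \<noteq> 0 \<and> det \<phi> = 0 \<and> (\<exists>\<zeta>. S *v rvec \<phi> - m = \<zeta> *\<^sub>R lower (rvec \<phi>))"
  unfolding neutral_stationary_point_def neutral_iff_det stationary_iff_drvec[OF assms]
  using drvec_orthogonal_iff by blast

section \<open>Lorentz transformations\<close>

text \<open>The time row of \<open>L\<close> is a unit timelike vector with positive time component.
  By Cauchy-Schwarz its spatial product with \<open>x\<close> cannot outweigh the time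
  product.\<close>

lemma lorentz_forward:
  assumes L: "L ** metric ** transpose L = metric" "L $ 0 $ 0 > 0"
    and x: "x \<bullet> lower x = 0" "x $ 0 > 0"
  shows "(L *v x) $ 0 > 0"
proof -
  define k where "k = L $ 0"
  have "(L ** metric ** transpose L) $ 0 $ 0 = k \<bullet> lower k"
    unfolding matrix_mul_assoc[symmetric]
    by (simp add: matrix_matrix_mult_def transpose_def metric_def inner_4 sum_UNIV_4 k_def)
  then have k: "k \<bullet> lower k = 1" unfolding L by (simp add: metric_def)
  define y where "y = vector [k$1, k$2, k$3] \<bullet> (vector [x$1, x$2, x$3] :: real^3)"
  have "y\<^sup>2 \<le> (norm (vector [k$1, k$2, k$3] :: real^3) * norm (vector [x$1, x$2, x$3] :: real^3))\<^sup>2"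
    unfolding y_def by (rule abs_le_square_iff[THEN iffD1]) (simp add: Cauchy_Schwarz_ineq2)
  also have "\<dots> = ((k$0)\<^sup>2 - 1) * (x$0)\<^sup>2"
    using k x(1) unfolding power_mult_distrib power2_norm_eq_inner
    by (simp add: inner_vec_def sum_3 vector_3 sum_UNIV_4 power2_eq_square algebra_simps)
  also have "\<dots> < (k$0 * x$0)\<^sup>2" using x(2) by (simp add: algebra_simps power_mult_distrib)
  finally have "\<bar>y\<bar> < k$0 * x$0" using L(2) x(2)
    by (intro power2_less_imp_less[of "\<bar>y\<bar>"]) (simp_all add: k_def)
  moreover have "(L *v x) $ 0 = k$0 * x$0 + y"
    by (simp add: matrix_vector_mult_4_nth k_def y_def inner_vec_def sum_3 vector_3)
  ultimately show ?thesis by linarith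
qed

lemma metric_metric: "metric ** metric = mat 1"
  unfolding matrix_matrix_mult_def metric_def mat_def vec_eq_iff sum_UNIV_4 forall_UNIV_4 by simp

lemma lower_lower: "lower (lower x) = x"
  by (simp add: vec4_eq_iff)

lemma lower_diff: "lower (x - y) = lower x - lower y"
  by (simp add: vec4_eq_iff)

lemma lower_scaleR: "lower (c *\<^sub>R x) = c *\<^sub>R lower x"
  by (simp add: vec4_eq_iff)

lemma lower_inner: "lower x \<bullet> y = x \<bullet> lower y"
  by (simp add: inner_4)

lemma lower_tensor_mult: "lower_tensor T *v x = lower (T *v lower x)"
  by (simp add: lower_tensor_def lower_def flip: matrix_vector_mul_assoc)

context
  fixes A assumes A: "transpose A ** metric ** A = metric"
begin

lemma lorentz_lower: "transpose A *v lower (A *v x) = lower x"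
  unfolding lower_def by (simp add: matrix_vector_mul_assoc matrix_mul_assoc A)

lemma lorentz_minkowski: "(A *v x) \<bullet> lower (A *v y) = x \<bullet> lower y"
  using inner_matrix_transpose[of x "transpose A" "lower (A *v y)"] by (simp add: lorentz_lower)

lemma lorentz_inverse: "(metric ** transpose A ** metric) ** A = mat 1"
    "A ** (metric ** transpose A ** metric) = mat 1"
proof -
  have "(metric ** transpose A ** metric) ** A = metric ** (transpose A ** metric ** A)"
    by (simp add: matrix_mul_assoc)
  then show "(metric ** transpose A ** metric) ** A = mat 1" unfolding A by (simp add: metric_metric)
  then show "A ** (metric ** transpose A ** metric) = mat 1" by (simp add: matrix_left_right_inverse)
qed

text \<open>Passes from the relation between columns to the one between rows, the form that
  \<open>lorentz_forward\<close> takes.\<close>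

lemma lorentz_transpose: "A ** metric ** transpose A = metric"
proof -
  have "A ** metric ** transpose A = A ** (metric ** transpose A ** metric) ** metric"
    by (metis matrix_mul_assoc matrix_mul_rid metric_metric)
  then show ?thesis by (simp add: lorentz_inverse)
qed

text \<open>Raising the index makes both sides upper-index vectors, to which the invertible
  \<open>A\<close> is applied; \<zeta> stays the same.\<close>

lemma lorentz_stationary_iff:
  "lower_tensor \<Lambda> *v r - lower M = \<zeta> *\<^sub>R lower r \<longleftrightarrow>
    (A ** \<Lambda> ** transpose A) *v lower (A *v r) - A *v M = \<zeta> *\<^sub>R (A *v r)"
proof -
  have "lower_tensor \<Lambda> *v r - lower M = \<zeta> *\<^sub>R lower r \<longleftrightarrow> \<Lambda> *v lower r - M = \<zeta> *\<^sub>R r"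
    unfolding lower_tensor_mult
    by (metis lower_diff lower_scaleR lower_lower)
  also have "\<dots> \<longleftrightarrow> A *v (\<Lambda> *v lower r - M) = A *v (\<zeta> *\<^sub>R r)"
    by (metis lorentz_inverse(1) matrix_vector_mul_assoc matrix_vector_mul_lid)
  also have "\<dots> \<longleftrightarrow> (A ** \<Lambda> ** transpose A) *v lower (A *v r) - A *v M = \<zeta> *\<^sub>R (A *v r)"
    by (simp add: matrix_vector_mult_diff_distrib matrix_vector_mult_scaleR lorentz_lower
        flip: matrix_vector_mul_assoc)
  finally show ?thesis .
qed

lemma lorentz_positivity:
  "r \<bullet> (lower_tensor \<Lambda> *v r) = lower (A *v r) \<bullet> ((A ** \<Lambda> ** transpose A) *v lower (A *v r))"
proof -
  have "lower (A *v r) \<bullet> ((A ** \<Lambda> ** transpose A) *v lower (A *v r)) =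
      (transpose A *v lower (A *v r)) \<bullet> (\<Lambda> *v (transpose A *v lower (A *v r)))"
    by (simp add: inner_matrix_transpose flip: matrix_vector_mul_assoc)
  then show ?thesis by (simp add: lorentz_lower lower_tensor_mult lower_inner)
qed

end

text \<open>The row relation for the inverse of \<open>A\<close>, so that
  \<open>lorentz_forward\<close> applies to it as well.\<close>

lemma lorentz_inverse_lorentz:
  assumes "transpose A ** metric ** A = metric"
  shows "(metric ** transpose A ** metric) ** metric ** transpose (metric ** transpose A ** metric) = metric"
proof -
  have "(metric ** transpose A ** metric) ** metric ** transpose (metric ** transpose A ** metric)
    = metric ** transpose A ** (metric ** metric) ** metric ** A ** metric"
    by (simp add: matrix_transpose_mul transpose_metric matrix_mul_assoc)
  also have "\<dots> = metric ** (transpose A ** metric ** A) ** metric"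
    by (simp only: metric_metric matrix_mul_rid matrix_mul_assoc)
  also have "\<dots> = metric" by (simp add: assms metric_metric)
  finally show ?thesis .
qed

lemma metric_conj_00: "(metric ** transpose A ** metric) $ 0 $ 0 = A $ 0 $ 0"
  by (simp add: matrix_matrix_mult_def sum_UNIV_4 metric_def transpose_def)

section \<open>The prototypical model\<close>

lemma sq_quotient_nonzero: "y \<noteq> 0 \<Longrightarrow> sq_quotient x y = ereal ((x / y)\<^sup>2)"
  by (simp add: sq_quotient_def power_divide)

lemma sq_quotient_zero: "sq_quotient x 0 = (if x = 0 then 0 else \<infinity>)"
  by (simp add: sq_quotient_def)

lemma sq_quotient_nonneg: "sq_quotient x y \<ge> 0"
  by (cases "y = 0") (simp_all add: sq_quotient_zero sq_quotient_nonzero)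

text \<open>Only an inequality, because for \<open>c = 0\<close> the quotient is 0 while
  \<open>x\<close> is arbitrary.\<close>

lemma sq_quotient_mult_le: "sq_quotient (c * x) c \<le> ereal (x\<^sup>2)"
  by (cases "c = 0") (simp_all add: sq_quotient_zero sq_quotient_nonzero)

lemma prototype_solution_iff:
  fixes M :: "real^4"
  assumes "M $ 2 = 0" "\<Lambda>0 > \<Lambda>2"
  shows "(\<exists>x \<zeta>. x $ 0 > 0 \<and> x \<bullet> lower x = 0 \<and> x $ 2 \<noteq> 0 \<and>
       diag4 \<Lambda>0 (- \<Lambda>1) (- \<Lambda>2) (- \<Lambda>3) *v lower x - M = \<zeta> *\<^sub>R x) \<longleftrightarrow>
     0 < M $ 0 \<and> sq_quotient (M $ 1) (\<Lambda>1 - \<Lambda>2) + sq_quotient (M $ 3) (\<Lambda>3 - \<Lambda>2)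
             < sq_quotient (M $ 0) (\<Lambda>0 - \<Lambda>2)" (is "?L \<longleftrightarrow> ?R")
proof -
  \<comment> \<open>Lowering \<open>x\<close> cancels the minus signs of the spatial diagonal
    entries.\<close>
  have eq: "diag4 \<Lambda>0 (- \<Lambda>1) (- \<Lambda>2) (- \<Lambda>3) *v lower x - M = \<zeta> *\<^sub>R x \<longleftrightarrow>
    M $ 0 = (\<Lambda>0 - \<zeta>) * x $ 0 \<and> M $ 1 = (\<Lambda>1 - \<zeta>) * x $ 1 \<and> (\<Lambda>2 - \<zeta>) * x $ 2 = 0 \<and>
    M $ 3 = (\<Lambda>3 - \<zeta>) * x $ 3" for x \<zeta>
    by (auto simp: vec4_eq_iff matrix_vector_mult_4_nth diag4_def assms algebra_simps)
  show ?thesis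
  proof
    assume ?L
    then obtain x \<zeta> where x: "x $ 0 > 0" "x \<bullet> lower x = 0" "x $ 2 \<noteq> 0"
      "M $ 0 = (\<Lambda>0 - \<zeta>) * x $ 0" "M $ 1 = (\<Lambda>1 - \<zeta>) * x $ 1" "(\<Lambda>2 - \<zeta>) * x $ 2 = 0"
      "M $ 3 = (\<Lambda>3 - \<zeta>) * x $ 3" unfolding eq by blast
    then have [simp]: "\<zeta> = \<Lambda>2" by simp
    have "sq_quotient (M $ 1) (\<Lambda>1 - \<Lambda>2) + sq_quotient (M $ 3) (\<Lambda>3 - \<Lambda>2)
        \<le> ereal ((x $ 1)\<^sup>2) + ereal ((x $ 3)\<^sup>2)"
      using x by (intro add_mono) (auto simp: sq_quotient_mult_le)
    also have "\<dots> < ereal ((x $ 0)\<^sup>2)"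
    proof -
      have "(x $ 2)\<^sup>2 > 0" using x by simp
      then show ?thesis using x(2) by (simp add: inner_4 power2_eq_square)
    qed
    also have "\<dots> = sq_quotient (M $ 0) (\<Lambda>0 - \<Lambda>2)"
      using x assms by (simp add: sq_quotient_nonzero)
    finally show ?R using x assms by simp
  next
    assume R: ?R
    \<comment> \<open>A strict bound on a sum of nonnegative terms excludes infinity, so a zero
      denominator occurs only with a zero numerator.\<close>
    have fin: "sq_quotient (M $ 1) (\<Lambda>1 - \<Lambda>2) \<noteq> \<infinity>" "sq_quotient (M $ 3) (\<Lambda>3 - \<Lambda>2) \<noteq> \<infinity>"
      using R sq_quotient_nonneg[of "M $ 1" "\<Lambda>1 - \<Lambda>2"] sq_quotient_nonneg[of "M $ 3" "\<Lambda>3 - \<Lambda>2"]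
      by auto
    define x0 where "x0 = M $ 0 / (\<Lambda>0 - \<Lambda>2)"
    \<comment> \<open>For equal eigenvalues real division sets this free component to 0; likewise
      for \<open>x3\<close>.\<close>
    define x1 where "x1 = M $ 1 / (\<Lambda>1 - \<Lambda>2)"
    define x3 where "x3 = M $ 3 / (\<Lambda>3 - \<Lambda>2)"
    have fin_eq: "sq_quotient a b = ereal ((a / b)\<^sup>2) \<and> a = b * (a / b)" if "sq_quotient a b \<noteq> \<infinity>" for a b
      using that by (cases "b = 0") (auto simp: sq_quotient_zero sq_quotient_nonzero split: if_splits)
    have lt: "x1\<^sup>2 + x3\<^sup>2 < x0\<^sup>2"
      using R fin_eq[OF fin(1)] fin_eq[OF fin(2)] assms
      by (simp add: x0_def x1_def x3_def sq_quotient_nonzero)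
    \<comment> \<open>The second component is chosen to make \<open>x\<close> lightlike.\<close>
    define x :: "real^4" where
      "x = (\<chi> \<mu>. if \<mu> = 0 then x0 else if \<mu> = 1 then x1
         else if \<mu> = 2 then sqrt (x0\<^sup>2 - x1\<^sup>2 - x3\<^sup>2) else x3)"
    have [simp]: "x $ 0 = x0" "x $ 1 = x1" "x $ 2 = sqrt (x0\<^sup>2 - x1\<^sup>2 - x3\<^sup>2)" "x $ 3 = x3"
      by (simp_all add: x_def)
    have "x $ 0 > 0" using R assms by (simp add: x0_def)
    moreover have "x \<bullet> lower x = 0" using lt by (simp add: inner_4 power2_eq_square)
    moreover have "x $ 2 \<noteq> 0" using lt by simp
    moreover have "M $ 0 = (\<Lambda>0 - \<Lambda>2) * x0" "M $ 1 = (\<Lambda>1 - \<Lambda>2) * x1" "M $ 3 = (\<Lambda>3 - \<Lambda>2) * x3"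
      using fin_eq[OF fin(1)] fin_eq[OF fin(2)] assms by (auto simp: x0_def x1_def x3_def)
    ultimately show ?L by (intro exI[of _ x] exI[of _ \<Lambda>2]) (simp add: eq)
  qed
qed

text \<open>Every real basis has a CP eigenvector as the preimage of its second axis, and by
  uniqueness this is parallel to \<open>n\<close>. So the relative phase vanishes in all real bases
  or in none, and the basis reached by \<open>U\<close> decides.\<close>

lemma spontaneously_CP_violating_iff:
  assumes sym: "transpose \<Lambda> = \<Lambda>"
    and U: "U \<in> SU2" and R: "induces U R" and Rn: "R *v from_spatial n = axis 2 c"
    and n: "CP_eigenvector M \<Lambda> n"
    and unique: "\<And>n'. CP_eigenvector M \<Lambda> n' \<Longrightarrow> \<exists>c. n' = c *\<^sub>R n"
  shows "spontaneously_CP_violating (potential M \<Lambda>) \<phi> \<longleftrightarrow>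
    neutral_stationary_point (potential M \<Lambda>) \<phi> \<and> (R *v rvec \<phi>) $ 2 \<noteq> 0"
proof -
  define S where "S = lower_tensor \<Lambda>"
  define m where "m = lower M"
  define N where "N = from_spatial n"
  have symS: "transpose S = S"
    unfolding S_def by (rule transpose_lower_tensor[OF sym])
  have pot: "potential M \<Lambda> = (\<lambda>\<phi>. quad m S (rvec \<phi>))"
    by (simp add: fun_eq_iff potential_eq_quad m_def S_def)
  have im: "Im (herm (V ** \<phi>) 1 2) = 0 \<longleftrightarrow> (transpose Q *v e2) \<bullet> rvec \<phi> = 0"
    if "V \<in> SU2" "induces V Q" for V Q
  proof -
    have "2 * Im (herm (V ** \<phi>) 1 2) = e2 \<bullet> (Q *v rvec \<phi>)"
      unfolding induced_rvec[OF that, symmetric] by (simp add: inner_axis' rvec_nth)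
    then show ?thesis unfolding inner_matrix_transpose by auto
  qed
  from n obtain c' where N: "m \<bullet> N = 0" "S *v N = c' *\<^sub>R N" "N \<noteq> 0"
    unfolding CP_eigenvector_iff[OF sym] m_def[symmetric] S_def[symmetric] N_def
    by (auto simp: vec_eq_iff[where 'b = 3] forall_3 vec4_eq_iff)
  have "axis 2 c = c *\<^sub>R e2" by (simp add: vec4_eq_iff)
  then have N_eq: "N = c *\<^sub>R (transpose R *v e2)"
    using induced_cancel(1)[OF U R, of N] Rn by (simp add: N_def matrix_vector_mult_scaleR)
  with N have c: "c \<noteq> 0" by auto
  then have e: "transpose R *v e2 = (1 / c) *\<^sub>R N" by (simp add: N_eq)
  have real: "real_coefficients (reparametrize U (potential M \<Lambda>))"
    unfolding pot real_coefficients_reparametrize_iff[OF U R symS] unfolding e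
    using N by (auto simp: matrix_vector_mult_scaleR)
  have R2: "(R *v rvec \<phi>) $ 2 = (transpose R *v e2) \<bullet> rvec \<phi>"
    unfolding inner_matrix_transpose[symmetric] by (simp add: inner_axis')
  have "N \<bullet> rvec \<phi> = 0"
    if V: "V \<in> SU2" "real_coefficients (reparametrize V (potential M \<Lambda>))"
      "Im (herm (V ** \<phi>) 1 2) = 0" for V
  proof -
    obtain Q where Q: "induces V Q" using induces_exists by blast
    define N' where "N' = transpose Q *v e2"
    have N': "m \<bullet> N' = 0" "\<exists>c. S *v N' = c *\<^sub>R N'"
      using V(2) unfolding pot real_coefficients_reparametrize_iff[OF V(1) Q symS] N'_def by auto
    \<comment> \<open>The induced map preserves time components, so the preimage of the second axis
      is purely spatial and can be compared with \<open>n\<close>.\<close>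
    have "N' $ 0 = 0" by (simp add: N'_def induced_0[OF V(1) Q])
    then have sp: "from_spatial (spatial N') = N'"
      by (simp add: vec4_eq_iff spatial_def)
    have "Q *v N' = e2" by (simp add: N'_def induced_cancel[OF V(1) Q])
    then have "N' \<noteq> 0" by auto
    then have "spatial N' \<noteq> 0" using sp by (metis from_spatial_nth vec4_eq_iff zero_index)
    then have "CP_eigenvector M \<Lambda> (spatial N')"
      unfolding CP_eigenvector_iff[OF sym] sp using N' by (simp add: m_def S_def)
    then obtain t where "spatial N' = t *\<^sub>R n" using unique by blast
    then have t: "N' = t *\<^sub>R N" by (subst sp[symmetric]) (simp add: N_def vec4_eq_iff)
    moreover have "N' \<bullet> rvec \<phi> = 0" using V(3) im[OF V(1) Q] by (simp add: N'_def)
    ultimately show ?thesis using \<open>N' \<noteq> 0\<close> by auto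
  qed
  then show ?thesis
    unfolding spontaneously_CP_violating_def explicitly_CP_conserving_def R2
    using U real im[OF U R] c by (auto simp: e)
qed

theorem proposition9:
  fixes M M' :: "real^4" and \<Lambda> :: "real^4^4" and n :: "real^3"
    and \<Lambda>0 \<Lambda>1 \<Lambda>2 \<Lambda>3 :: real
  assumes "transpose \<Lambda> = \<Lambda>"
    and "positivity_constraint \<Lambda>"
    and "CP_eigenvector M \<Lambda> n"
    and "\<And>n'. CP_eigenvector M \<Lambda> n' \<Longrightarrow> \<exists>c. n' = c *\<^sub>R n"
    and "prototypical_model M \<Lambda> n M' \<Lambda>0 \<Lambda>1 \<Lambda>2 \<Lambda>3"
  shows "(\<exists>\<phi>. spontaneously_CP_violating (potential M \<Lambda>) \<phi>) \<longleftrightarrow>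
           0 < M' $ 0 \<and>
           sq_quotient (M' $ 1) (\<Lambda>1 - \<Lambda>2) + sq_quotient (M' $ 3) (\<Lambda>3 - \<Lambda>2)
             < sq_quotient (M' $ 0) (\<Lambda>0 - \<Lambda>2)"
proof -
  from assms(5) obtain U R K c where U: "U \<in> SU2" and R: "induces U R"
    and Rn: "R *v from_spatial n = axis 2 c"
    and K: "proper_orthochronous K" "acts_only_on_013 K" and M': "M' = (K ** R) *v M"
    and D: "(K ** R) ** \<Lambda> ** transpose (K ** R) = diag4 \<Lambda>0 (- \<Lambda>1) (- \<Lambda>2) (- \<Lambda>3)"
    unfolding prototypical_model_def by blast
  define A where "A = K ** R"
  \<comment> \<open>The inverse of \<open>A\<close>, leading from the prototypical model back to the
    given parameters.\<close>
  define B where "B = metric ** transpose A ** metric"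
  have "metric ** R = R ** metric"
    using induced_lower[OF U R] by (simp add: matrix_eq lower_def flip: matrix_vector_mul_assoc)
  then have "transpose R ** metric ** R = metric"
    using induced_orthogonal(1)[OF U R] by (metis matrix_mul_assoc matrix_mul_lid)
  then have A: "transpose A ** metric ** A = metric"
    using K(1) unfolding A_def proper_orthochronous_def matrix_transpose_mul
    by (metis matrix_mul_assoc)
  \<comment> \<open>\<open>R\<close> fixes the time axis, so \<open>A\<close> inherits its time-time
    entry from \<open>K\<close>.\<close>
  have "A *v axis 0 1 = K *v axis 0 1"
    by (simp add: A_def induced_time(2)[OF U R] flip: matrix_vector_mul_assoc)
  then have "(A *v axis 0 1) $ 0 = (K *v axis 0 1) $ 0" by simp
  then have A00: "A $ 0 $ 0 > 0"
    using K(1) unfolding matrix_vector_mult_4_nth proper_orthochronous_def by simp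
  have AB: "A *v (B *v x) = x" for x
    by (simp add: B_def matrix_vector_mul_assoc lorentz_inverse(2)[OF A])
  have fwd: "(A *v x) $ 0 > 0" if "x \<bullet> lower x = 0" "x $ 0 > 0" for x
    by (rule lorentz_forward[OF lorentz_transpose[OF A] A00 that])
  have bwd: "(B *v x) $ 0 > 0" if "x \<bullet> lower x = 0" "x $ 0 > 0" for x
    using lorentz_forward[OF lorentz_inverse_lorentz[OF A] _ that] A00
    unfolding B_def metric_conj_00 by blast
  have light: "(B *v x) \<bullet> lower (B *v x) = x \<bullet> lower x" for x
    using lorentz_minkowski[OF A, of "B *v x" "B *v x"] unfolding AB by simp
  have K2: "(K *v x) $ 2 = x $ 2" for x
    using K(2) unfolding acts_only_on_013_def row_def matrix_vector_mult_4_nth by (simp add: vec4_eq_iff)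

  have "M' $ 2 = 0"
  proof -
    have "from_spatial n \<noteq> 0" and Mn: "lower M \<bullet> from_spatial n = 0"
      using assms(3) unfolding CP_eigenvector_iff[OF assms(1)]
      by (auto simp: vec_eq_iff[where 'b = 3] forall_3 vec4_eq_iff)
    have "c \<noteq> 0"
    proof
      assume "c = 0"
      then have "R *v from_spatial n = 0" by (simp add: Rn)
      then show False
        using induced_cancel(1)[OF U R, of "from_spatial n"] \<open>from_spatial n \<noteq> 0\<close> by simp
    qed
    \<comment> \<open>\<open>K\<close> leaves the second component alone and \<open>R\<close> is
      orthogonal, so this component of \<open>M'\<close> measures the product of \<open>M\<close>
      with \<open>n\<close>.\<close>
    have "c * M' $ 2 = axis 2 c \<bullet> (R *v M)"
      by (simp add: M' K2 inner_axis' flip: matrix_vector_mul_assoc)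
    also have "\<dots> = from_spatial n \<bullet> M"
      unfolding Rn[symmetric] inner_matrix_transpose induced_cancel(1)[OF U R] ..
    also have "\<dots> = 0" using Mn by (simp add: inner_4 algebra_simps)
    finally show ?thesis using \<open>c \<noteq> 0\<close> by simp
  qed
  moreover have "\<Lambda>0 > \<Lambda>2"
  proof -
    define x :: "real^4" where "x = axis 0 1 + e2"
    have x: "x $ 0 > 0" "x \<bullet> lower x = 0" by (simp_all add: x_def inner_4)
    \<comment> \<open>Positivity is given for the original tensor, hence the test vector is first
      carried back to a forward lightlike one.\<close>
    have "(B *v x) \<bullet> (lower_tensor \<Lambda> *v (B *v x)) > 0"
      using assms(2) bwd[OF x(2,1)] x light[of x] unfolding positivity_constraint_def
      by (metis less_eq_real_def order_refl zero_index less_irrefl)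
    then show ?thesis
      unfolding lorentz_positivity[OF A] AB D[folded A_def]
      by (simp add: inner_4 matrix_vector_mult_4_nth x_def diag4_def)
  qed
  moreover have "(\<exists>\<phi>. spontaneously_CP_violating (potential M \<Lambda>) \<phi>) \<longleftrightarrow>
    (\<exists>x \<zeta>. x $ 0 > 0 \<and> x \<bullet> lower x = 0 \<and> x $ 2 \<noteq> 0 \<and>
       diag4 \<Lambda>0 (- \<Lambda>1) (- \<Lambda>2) (- \<Lambda>3) *v lower x - M' = \<zeta> *\<^sub>R x)" (is "_ \<longleftrightarrow> ?R")
  proof -
    have pot: "potential M \<Lambda> = (\<lambda>\<phi>. quad (lower M) (lower_tensor \<Lambda>) (rvec \<phi>))"
      by (simp add: fun_eq_iff potential_eq_quad)
    have A2: "(R *v x) $ 2 = (A *v x) $ 2" for x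
      by (simp add: A_def K2 flip: matrix_vector_mul_assoc)
    have CP: "spontaneously_CP_violating (potential M \<Lambda>) \<phi> \<longleftrightarrow>
      neutral_stationary_point (potential M \<Lambda>) \<phi> \<and> (R *v rvec \<phi>) $ 2 \<noteq> 0" for \<phi>
      by (rule spontaneously_CP_violating_iff[OF assms(1) U R Rn assms(3)]) (rule assms(4))
    have violating: "spontaneously_CP_violating (potential M \<Lambda>) \<phi> \<longleftrightarrow>
      \<phi> \<noteq> 0 \<and> det \<phi> = 0 \<and> (A *v rvec \<phi>) $ 2 \<noteq> 0 \<and> (\<exists>\<zeta>.
        diag4 \<Lambda>0 (- \<Lambda>1) (- \<Lambda>2) (- \<Lambda>3) *v lower (A *v rvec \<phi>) - M' = \<zeta> *\<^sub>R (A *v rvec \<phi>))" for \<phi>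
      unfolding CP A2 D[symmetric] M'
      unfolding pot neutral_stationary_iff[OF transpose_lower_tensor[OF assms(1)]]
        lorentz_stationary_iff[OF A] A_def[symmetric] by blast
    show ?thesis
    proof
      assume "\<exists>\<phi>. spontaneously_CP_violating (potential M \<Lambda>) \<phi>"
      then obtain \<phi> \<zeta> where \<phi>: "\<phi> \<noteq> 0" "det \<phi> = 0" "(A *v rvec \<phi>) $ 2 \<noteq> 0"
        "diag4 \<Lambda>0 (- \<Lambda>1) (- \<Lambda>2) (- \<Lambda>3) *v lower (A *v rvec \<phi>) - M' = \<zeta> *\<^sub>R (A *v rvec \<phi>)"
        unfolding violating by blast
      then have "rvec \<phi> \<bullet> lower (rvec \<phi>) = 0" by (simp add: minkowski_rvec)
      with \<phi> fwd[of "rvec \<phi>"] rvec_0_pos[of \<phi>] lorentz_minkowski[OF A, of "rvec \<phi>" "rvec \<phi>"]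
      show ?R by (intro exI[of _ "A *v rvec \<phi>"] exI[of _ \<zeta>]) simp
    next
      assume ?R
      then obtain x \<zeta> where x: "x $ 0 > 0" "x \<bullet> lower x = 0" "x $ 2 \<noteq> 0"
        "diag4 \<Lambda>0 (- \<Lambda>1) (- \<Lambda>2) (- \<Lambda>3) *v lower x - M' = \<zeta> *\<^sub>R x" by blast
      \<comment> \<open>A solution in the prototypical model is carried back to the forward cone,
        where some configuration realizes it.\<close>
      obtain \<phi> where \<phi>: "rvec \<phi> = B *v x"
        by (rule rvec_onto_cone[of "B *v x"]) (use bwd[of x] x light[of x] in auto)
      then have "rvec \<phi> \<noteq> 0" using AB[of x] x by auto
      then have "\<phi> \<noteq> 0" by (auto simp: rvec_eq_sesqui vec4_eq_iff rvec_sesqui_nth herm_sesqui_def)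
      moreover have "det \<phi> = 0" using minkowski_rvec[of \<phi>] x light[of x] by (simp add: \<phi>)
      ultimately show "\<exists>\<phi>. spontaneously_CP_violating (potential M \<Lambda>) \<phi>"
        unfolding violating using x AB[of x] \<phi> by metis
    qed
  qed
  ultimately show ?thesis using prototype_solution_iff by blast
qed

end
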